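(* Let $A\in\mathbb{R}^{m\times n}$ and let $R\subseteq\mathbb{R}^n$ be a nonempty polyhedron. Then for all $b\in A(R)+\mathbb{R}^m_+$ and $u\in R$, $$\operatorname{dist}(u,P_A(b)\cap R)\le H(A\vert R)\cdot\operatorname{dist}(b-Au,\mathbb{R}^m_+)\le H(A\vert R)\cdot\|(Au-b)_+\|.$$ Furthermore the first bound is tight: if $H(A\vert R)>0$ then there exist $b\in A(R)+\mathbb{R}^m_+$ and $u\in R$ such that $$\operatorname{dist}(u,P_A(b)\cap R)=H(A\vert R)\cdot\operatorname{dist}(b-Au,\mathbb{R}^m_+)>0.$$
   Context: $\mathbb{R}^n$ and $\mathbb{R}^m$ are each endowed with an arbitrary norm (not necessarily Euclidean), both denoted $\|\cdot\|$. For a nonempty closed set $S$, $\operatorname{dist}(u,S)=\min_{x\in S}\|u-x\|$. $P_A(b):=\{x\in\mathbb{R}^n:Ax\le b\}$, $A(R)=\{Ax:x\in R\}$, $(Au-b)_+:=\max(0,Au-b)$ componentwise, $[m]=\{1,\dots,m\}$. For $J\subseteq[m]$, $A_J$ is the submatrix of rows indexed by $J$ and $y_J$ the corresponding subvector. For a polyhedron $Q\subseteq\mathbb{R}^d$ and $u\in Q$, the tangent cone is $T_Q(u)=\{d\in\mathbb{R}^d: u+td\in Q\text{ for some }t>0\}$, and $\mathcal{T}(Q):=\{T_Q(u):u\in Q\}$, a finite collection. Define $$\mathcal{S}(A\vert R):=\{(J,K): J\subseteq[m],\ K\in\mathcal{T}(R),\ A_J(K)+\mathbb{R}^J_+=\mathbb{R}^J\},$$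 $$H_{J,K}(A):=\max_{y\in\mathbb{R}^m,\ \|y\|\le1}\ \min_{x\in K,\ A_Jx\le y_J}\|x\|$$ for $(J,K)\in\mathcal{S}(A\vert R)$, with $H_{J,K}(A):=0$ if $J=\emptyset$ (pairs with $J=\emptyset$ belong to $\mathcal S(A\vert R)$), and $$H(A\vert R):=\max_{(J,K)\in\mathcal{S}(A\vert R)}H_{J,K}(A).$$ *)

theory Defs
  imports "HOL-Analysis.Analysis" "HOL-Library.Set_Algebras"
begin

(* Arbitrary norms are passed as functions, because the norm of the library type real^'n
   is the Euclidean one. *)
definition is_norm :: "('a::real_vector \<Rightarrow> real) \<Rightarrow> bool" where
  "is_norm N \<longleftrightarrow>
     (\<forall>x. 0 \<le> N x) \<and> (\<forall>x. N x = 0 \<longleftrightarrow> x = 0) \<and>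
     (\<forall>c x. N (c *\<^sub>R x) = \<bar>c\<bar> * N x) \<and> (\<forall>x y. N (x + y) \<le> N x + N y)"

(* A minimum whenever S is nonempty and closed. *)
definition norm_dist :: "('a::real_vector \<Rightarrow> real) \<Rightarrow> 'a \<Rightarrow> 'a set \<Rightarrow> real" where
  "norm_dist N u S = (INF x\<in>S. N (u - x))"

definition nonneg_orthant :: "(real^'m) set" where
  "nonneg_orthant = {y. 0 \<le> y}"

definition pos_part :: "real^'m \<Rightarrow> real^'m" where
  "pos_part y = (\<chi> i. max 0 (y $ i))"

definition solution_set :: "real^'n^'m \<Rightarrow> real^'m \<Rightarrow> (real^'n) set" where
  "solution_set A b = {x. A *v x \<le> b}"

definition tangent_cone :: "'a::real_vector set \<Rightarrow> 'a \<Rightarrow> 'a set" where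
  "tangent_cone Q u = {d. \<exists>t>0. u + t *\<^sub>R d \<in> Q}"

definition tangent_cones :: "'a::real_vector set \<Rightarrow> 'a set set" where
  "tangent_cones Q = tangent_cone Q ` Q"

(* R^J, for J a set of indices, is identified with the coordinate subspace of R^m of the vectors
   vanishing outside J.  Accordingly, subvec J y represents y_J, and, applied to a matrix (a vector
   of rows), subvec J A represents A_J, with zero rows in place of the omitted ones. *)
definition subvec :: "'m set \<Rightarrow> 'a::zero^'m \<Rightarrow> 'a^'m" where
  "subvec J v = (\<chi> i. if i \<in> J then v $ i else 0)"

definition coord_space :: "'m set \<Rightarrow> (real^'m) set" where
  "coord_space J = {y. \<forall>i. i \<notin> J \<longrightarrow> y $ i = 0}"

definition surj_pairs :: "real^'n^'m \<Rightarrow> (real^'n) set \<Rightarrow> ('m set \<times> (real^'n) set) set" where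
  "surj_pairs A R = {(J, K). K \<in> tangent_cones R \<and>
     (*v) (subvec J A) ` K + (coord_space J \<inter> nonneg_orthant) = coord_space J}"

(* For (J, K) in surj_pairs A R with R a polyhedron, the infimum and the supremum are attained. *)
definition hoffman_pair ::
    "(real^'n \<Rightarrow> real) \<Rightarrow> (real^'m \<Rightarrow> real) \<Rightarrow> real^'n^'m \<Rightarrow> 'm set \<Rightarrow> (real^'n) set \<Rightarrow> real" where
  "hoffman_pair Nn Nm A J K =
     (if J = {} then 0
      else SUP y\<in>{y. Nm y \<le> 1}. INF x\<in>{x \<in> K. subvec J A *v x \<le> subvec J y}. Nn x)"

(* The set of pairs is finite for a polyhedron R, which has finitely many tangent cones. *)
definition hoffman ::
    "(real^'n \<Rightarrow> real) \<Rightarrow> (real^'m \<Rightarrow> real) \<Rightarrow> real^'n^'m \<Rightarrow> (real^'n) set \<Rightarrow> real" where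
  "hoffman Nn Nm A R = Max ((\<lambda>(J, K). hoffman_pair Nn Nm A J K) ` surj_pairs A R)"

end

theory Submission
  imports Defs
begin

text \<open>If some x0 in R satisfies all inequalities strictly, let p be a nearest point to u in the
  solution set, J the active rows at p and K the tangent cone of R at p. The direction x0 - p shows
  that (J, K) is a surjective pair. Whenever z in K satisfies A z \<le> b - A u on J, the direction
  z + (u - p) is feasible at p, so optimality of p gives N (u - p) \<le> N z; minimizing over z yields
  the bound by the constant of (J, K). Relaxing b and a compactness argument remove strictness. For
  tightness, take u to be an apex of a maximizing cone and scale down a maximizing right-hand side
  until its solutions stay in R.\<close>

subsection \<open>Norms\<close>

lemma
  assumes "is_norm N"
  shows is_norm_nonneg: "0 \<le> N x"
    and is_norm_eq_0: "N x = 0 \<longleftrightarrow> x = 0"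
    and is_norm_scaleR: "N (c *\<^sub>R x) = \<bar>c\<bar> * N x"
    and is_norm_triangle: "N (x + y) \<le> N x + N y"
  using assms by (auto simp: is_norm_def)

lemma is_norm_uminus: "is_norm N \<Longrightarrow> N (- x) = N x"
  using is_norm_scaleR[of N "-1" x] by simp

lemma is_norm_norm: "is_norm norm"
  by (auto simp: is_norm_def norm_triangle_ineq)

text \<open>Homogeneity and the triangle inequality make \<open>N\<close> convex, and a finite
  convex function on a Euclidean space is continuous.\<close>

lemma is_norm_continuous_on:
  fixes N :: "'a::euclidean_space \<Rightarrow> real"
  assumes "is_norm N"
  shows "continuous_on S N"
proof -
  have "convex_on UNIV N"
    using assms by (intro convex_onI)
      (auto simp: is_norm_scaleR intro: order_trans[OF is_norm_triangle])
  then have "continuous_on UNIV N"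
    by (intro convex_on_continuous) auto
  then show ?thesis
    by (rule continuous_on_subset) simp
qed

text \<open>By compactness \<open>N\<close> has a positive minimum on the Euclidean unit sphere;
  homogeneity carries the bound to all vectors. This transfers Euclidean boundedness to balls of
  \<open>N\<close>.\<close>

lemma is_norm_norm_bound:
  fixes N :: "'a::euclidean_space \<Rightarrow> real"
  assumes N: "is_norm N"
  obtains C where "C > 0" "\<And>x. norm x \<le> C * N x"
proof -
  obtain x0 where x0: "x0 \<in> sphere (0::'a) 1" "\<And>x. x \<in> sphere 0 1 \<Longrightarrow> N x0 \<le> N x"
    using continuous_attains_inf[OF compact_sphere _ is_norm_continuous_on[OF N]]
    by (metis sphere_eq_empty not_one_less_zero less_imp_not_less)
  have pos: "N x0 > 0"
    using x0(1) is_norm_nonneg[OF N, of x0] is_norm_eq_0[OF N, of x0] by force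
  show ?thesis
  proof
    show "1 / N x0 > 0" using pos by simp
    fix x :: 'a
    show "norm x \<le> 1 / N x0 * N x"
    proof (cases "x = 0")
      case False
      then have "N x0 \<le> N ((1 / norm x) *\<^sub>R x)"
        by (intro x0) simp
      also have "\<dots> = N x / norm x"
        using N by (simp add: is_norm_scaleR)
      finally show ?thesis
        using False pos by (simp add: field_simps)
    qed (use is_norm_eq_0[OF N, of 0] in simp)
  qed
qed

lemma is_norm_compact_cball:
  fixes N :: "'a::euclidean_space \<Rightarrow> real"
  assumes N: "is_norm N"
  shows "compact {x. N (u - x) \<le> r}"
proof -
  obtain C where C: "C > 0" "\<And>x. norm x \<le> C * N x"
    using is_norm_norm_bound[OF N] by blast
  have "continuous_on UNIV (\<lambda>x. N (u - x))"
    by (rule continuous_on_compose2[OF is_norm_continuous_on[OF N, of UNIV]])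
      (auto intro!: continuous_intros)
  then have "closed {x. N (u - x) \<le> r}"
    by (intro closed_Collect_le continuous_intros)
  moreover have "{x. N (u - x) \<le> r} \<subseteq> cball u (C * r)"
  proof clarsimp
    fix x assume "N (u - x) \<le> r"
    then have "C * N (u - x) \<le> C * r"
      using C(1) by simp
    then show "dist u x \<le> C * r"
      using C(2)[of "u - x"] by (simp add: dist_norm)
  qed
  ultimately show ?thesis
    using bounded_cball bounded_subset compact_eq_bounded_closed by blast
qed

lemma is_norm_nearest_point:
  fixes N :: "'a::euclidean_space \<Rightarrow> real"
  assumes N: "is_norm N" and "closed S" "S \<noteq> {}"
  obtains p where "p \<in> S" "\<And>x. x \<in> S \<Longrightarrow> N (u - p) \<le> N (u - x)"
proof -
  obtain s where s: "s \<in> S" using assms by blast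
  \<comment> \<open>Only points at least as near to \<open>u\<close> as \<open>s\<close> compete,
    and these form a compact set.\<close>
  let ?T = "{x. N (u - x) \<le> N (u - s)} \<inter> S"
  have cont: "continuous_on ?T (\<lambda>x. N (u - x))"
    by (rule continuous_on_compose2[OF is_norm_continuous_on[OF N, of UNIV]])
      (auto intro!: continuous_intros)
  have "compact ?T"
    using is_norm_compact_cball[OF N] \<open>closed S\<close> by (rule compact_Int_closed)
  moreover have "?T \<noteq> {}" using s by blast
  ultimately obtain p where p: "p \<in> ?T" "\<And>x. x \<in> ?T \<Longrightarrow> N (u - p) \<le> N (u - x)"
    using continuous_attains_inf[OF _ _ cont] by blast
  show ?thesis
  proof
    show "p \<in> S" using p by blast
    show "N (u - p) \<le> N (u - x)" if "x \<in> S" for x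
      using p(1) p(2)[of x] that by fastforce
  qed
qed

section \<open>Distance to a set in an arbitrary norm\<close>

lemma norm_dist_le:
  assumes "is_norm N" "x \<in> S"
  shows "norm_dist N u S \<le> N (u - x)"
  unfolding norm_dist_def
  by (intro cINF_lower bdd_belowI2[of _ 0] is_norm_nonneg[OF assms(1)] assms(2))

lemma le_norm_dist:
  assumes "S \<noteq> {}" "\<And>x. x \<in> S \<Longrightarrow> c \<le> N (u - x)"
  shows "c \<le> norm_dist N u S"
  unfolding norm_dist_def using assms by (intro cINF_greatest) auto


subsection \<open>Tangent cones\<close>

text \<open>An inactive constraint has slack, so it survives every sufficiently small step in any
  direction.\<close>

lemma eventually_add_mult_le_at_right_0:
  fixes \<alpha> \<beta> \<gamma> :: real
  assumes "\<alpha> < \<beta>"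
  shows "\<forall>\<^sub>F t in at_right 0. \<alpha> + t * \<gamma> \<le> \<beta>"
proof -
  have "((\<lambda>t. \<alpha> + t * \<gamma>) \<longlongrightarrow> \<alpha> + 0 * \<gamma>) (at_right 0)"
    by (intro tendsto_intros)
  then have "\<forall>\<^sub>F t in at_right 0. \<alpha> + t * \<gamma> < \<beta>"
    using assms by (intro order_tendstoD(2)) auto
  then show ?thesis
    by (rule eventually_mono) simp
qed

lemma eventually_at_right_0E:
  assumes "\<forall>\<^sub>F t in at_right (0::real). P t"
  obtains t where "t > 0" "P t"
  using eventually_happens'[OF trivial_limit_at_right_real
      eventually_conj[OF eventually_at_right_less assms]] by blast

text \<open>The segment from \<open>u\<close> to \<open>u + s *\<^sub>R d\<close> lies in
  \<open>Q\<close>, so all shorter steps do too. The eventual form lets several such conditions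
  share one step length.\<close>

lemma tangent_cone_eventually:
  assumes "convex Q" "u \<in> Q" "d \<in> tangent_cone Q u"
  shows "\<forall>\<^sub>F t in at_right 0. u + t *\<^sub>R d \<in> Q"
proof -
  obtain s where s: "s > 0" "u + s *\<^sub>R d \<in> Q"
    using assms by (auto simp: tangent_cone_def)
  have "u + t *\<^sub>R d \<in> Q" if t: "0 < t" "t < s" for t
  proof -
    have "(1 - t / s) *\<^sub>R u + (t / s) *\<^sub>R (u + s *\<^sub>R d) \<in> Q"
      using s t assms by (intro convexD) auto
    moreover have "(1 - t / s) *\<^sub>R u + (t / s) *\<^sub>R (u + s *\<^sub>R d) = u + t *\<^sub>R d"
      using s by (simp add: algebra_simps)
    ultimately show ?thesis by simp
  qed
  then show ?thesis
    using s(1) by (auto simp: eventually_at_right_field)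
qed

lemma tangent_cone_diff: "x \<in> Q \<Longrightarrow> x - u \<in> tangent_cone Q u"
  unfolding tangent_cone_def by (auto intro!: exI[of _ 1])

lemma tangent_cone_scaleR:
  assumes "u \<in> Q" "d \<in> tangent_cone Q u" "0 \<le> c"
  shows "c *\<^sub>R d \<in> tangent_cone Q u"
proof (cases "c = 0")
  case True
  then show ?thesis using tangent_cone_diff[OF assms(1), of u] by simp
next
  case False
  obtain s where "s > 0" "u + s *\<^sub>R d \<in> Q"
    using assms by (auto simp: tangent_cone_def)
  then show ?thesis
    using False assms(3) unfolding tangent_cone_def by (auto intro!: exI[of _ "s / c"])
qed

text \<open>With a common step \<open>t\<close>, the midpoint of \<open>u + t *\<^sub>R d\<close>
  and \<open>u + t *\<^sub>R e\<close> is a step of length \<open>t/2\<close> along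
  \<open>d + e\<close>.\<close>

lemma tangent_cone_add:
  assumes "convex Q" "u \<in> Q" "d \<in> tangent_cone Q u" "e \<in> tangent_cone Q u"
  shows "d + e \<in> tangent_cone Q u"
proof -
  have "\<forall>\<^sub>F t in at_right 0. u + t *\<^sub>R d \<in> Q \<and> u + t *\<^sub>R e \<in> Q"
    using assms by (intro eventually_conj tangent_cone_eventually)
  then obtain t :: real where t: "0 < t" "u + t *\<^sub>R d \<in> Q" "u + t *\<^sub>R e \<in> Q"
    by (rule eventually_at_right_0E) blast
  have "(1/2) *\<^sub>R (u + t *\<^sub>R d) + (1/2) *\<^sub>R (u + t *\<^sub>R e) \<in> Q"
    using t assms(1) by (intro convexD) auto
  moreover have "(1/2) *\<^sub>R (u + t *\<^sub>R d) + (1/2) *\<^sub>R (u + t *\<^sub>R e)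
      = (1/2 + 1/2) *\<^sub>R u + (t/2) *\<^sub>R (d + e)"
    by (simp only: scaleR_left_distrib scaleR_right_distrib scaleR_scaleR) (simp add: ac_simps)
  ultimately show ?thesis
    using t(1) unfolding tangent_cone_def by (auto intro!: exI[of _ "t/2"])
qed

lemma finite_tangent_cones:
  fixes Q :: "'a::euclidean_space set"
  assumes "polyhedron Q"
  shows "finite (tangent_cones Q)"
proof -
  obtain F where F: "finite F" "Q = \<Inter>F" "\<forall>h\<in>F. \<exists>a b. a \<noteq> 0 \<and> h = {x. a \<bullet> x \<le> b}"
    using assms unfolding polyhedron_def by blast
  then obtain a b where ab: "\<And>h. h \<in> F \<Longrightarrow> h = {x. a h \<bullet> x \<le> b h}"
    by metis
  have Q: "x \<in> Q \<longleftrightarrow> (\<forall>h\<in>F. a h \<bullet> x \<le> b h)" for x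
    using F(2) ab by blast
  \<comment> \<open>Finitely many active sets, hence finitely many cones.\<close>
  have "tangent_cone Q u = {d. \<forall>h\<in>{h \<in> F. a h \<bullet> u = b h}. a h \<bullet> d \<le> 0}" if u: "u \<in> Q" for u
  proof (intro equalityI subsetI; clarsimp)
    fix d h assume "d \<in> tangent_cone Q u" "h \<in> F" "a h \<bullet> u = b h"
    then show "a h \<bullet> d \<le> 0"
      by (auto simp: tangent_cone_def Q inner_add_right mult_le_0_iff)
  next
    fix d assume d: "\<forall>h. h \<in> F \<and> a h \<bullet> u = b h \<longrightarrow> a h \<bullet> d \<le> 0"
    \<comment> \<open>Active constraints do not increase along \<open>d\<close>, inactive ones have
      slack, and there are finitely many, so one step length works for all.\<close>
    have "\<forall>\<^sub>F t in at_right 0. \<forall>h\<in>F. a h \<bullet> u + t * (a h \<bullet> d) \<le> b h"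
    proof (intro eventually_ball_finite F(1) ballI)
      fix h assume h: "h \<in> F"
      show "\<forall>\<^sub>F t in at_right 0. a h \<bullet> u + t * (a h \<bullet> d) \<le> b h"
      proof (cases "a h \<bullet> u = b h")
        case True
        then show ?thesis
          using d h eventually_at_right_less[of "0::real"]
          by (auto elim!: eventually_mono simp: mult_nonneg_nonpos)
      next
        case False
        then show ?thesis
          using u h by (intro eventually_add_mult_le_at_right_0) (auto simp: Q less_le)
      qed
    qed
    then obtain t where "t > 0" "\<forall>h\<in>F. a h \<bullet> u + t * (a h \<bullet> d) \<le> b h"
      by (rule eventually_at_right_0E)
    then show "d \<in> tangent_cone Q u"
      by (auto simp: tangent_cone_def Q inner_add_right)
  qed
  then have "tangent_cones Q \<subseteq> (\<lambda>G. {d. \<forall>h\<in>G. a h \<bullet> d \<le> 0}) ` Pow F"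
    unfolding tangent_cones_def by blast
  then show ?thesis
    using F(1) by (meson finite_Pow_iff finite_imageI finite_subset)
qed


subsection \<open>The pairs and their constants\<close>

lemma subvec_mult_nth: "(subvec J A *v x) $ i = (if i \<in> J then (A *v x) $ i else 0)"
  by (simp add: subvec_def matrix_vector_mult_def)

lemma subvec_mult_le_iff:
  fixes A :: "real^'n^'m"
  shows "subvec J A *v x \<le> subvec J y \<longleftrightarrow> (\<forall>i\<in>J. (A *v x) $ i \<le> y $ i)"
  by (auto simp: less_eq_vec_def subvec_mult_nth subvec_def[of J y])

text \<open>Surjectivity amounts to a direction in \<open>K\<close> that strictly decreases all rows
  in \<open>J\<close>: a large multiple of it falls below any target on \<open>J\<close>, and the
  orthant supplies the difference.\<close>

lemma surj_pairs_iff: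
  assumes "convex R"
  shows "(J, K) \<in> surj_pairs A R \<longleftrightarrow>
    K \<in> tangent_cones R \<and> (\<exists>z\<in>K. \<forall>i\<in>J. (A *v z) $ i < 0)"
proof (cases "K \<in> tangent_cones R")
  case True
  then obtain w where w: "w \<in> R" "K = tangent_cone R w"
    by (auto simp: tangent_cones_def)
  have "(\<exists>z\<in>K. \<forall>i\<in>J. (A *v z) $ i < 0)"
    if eq: "(*v) (subvec J A) ` K + (coord_space J \<inter> nonneg_orthant) = coord_space J"
  proof -
    \<comment> \<open>Reaching the target -1 in all rows of \<open>J\<close> with a nonnegative
      remainder forces these rows of \<open>A *v z\<close> to be at most -1.\<close>
    have "subvec J (- 1) \<in> coord_space J"
      by (simp add: coord_space_def subvec_def)
    then have "subvec J (- 1) \<in> (*v) (subvec J A) ` K + (coord_space J \<inter> nonneg_orthant)"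
      by (simp only: eq)
    then obtain z v where z: "z \<in> K" "v \<in> nonneg_orthant" "subvec J (- 1) = subvec J A *v z + v"
      by (fastforce elim: set_plus_elim)
    have "(A *v z) $ i < 0" if "i \<in> J" for i
    proof -
      have "- 1 = (A *v z) $ i + v $ i"
        using arg_cong[OF z(3), of "\<lambda>x. x $ i"] that
        by (simp add: subvec_mult_nth subvec_def[of J "- 1"])
      moreover have "0 \<le> v $ i"
        using z(2) by (simp add: nonneg_orthant_def less_eq_vec_def)
      ultimately show ?thesis by linarith
    qed
    then show ?thesis using z(1) by blast
  qed
  moreover have "(*v) (subvec J A) ` K + (coord_space J \<inter> nonneg_orthant) = coord_space J"
    if z: "z \<in> K" "\<forall>i\<in>J. (A *v z) $ i < 0" for z
  proof (intro equalityI subsetI)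
    fix y assume "y \<in> (*v) (subvec J A) ` K + (coord_space J \<inter> nonneg_orthant)"
    then show "y \<in> coord_space J"
      by (auto elim!: set_plus_elim simp: coord_space_def subvec_mult_nth)
  next
    fix y assume y: "y \<in> coord_space J"
    \<comment> \<open>The sum dominates each ratio, so \<open>s\<close> times the negative number
      \<open>(A *v z) $ i\<close> is at most -|\<open>y $ i\<close>|; an empty \<open>J\<close> is
      covered as well.\<close>
    define s where "s = (\<Sum>i\<in>J. \<bar>y $ i / (A *v z) $ i\<bar>)"
    have s: "s * (A *v z) $ i \<le> y $ i" if "i \<in> J" for i
    proof -
      have "\<bar>y $ i / (A *v z) $ i\<bar> \<le> s"
        unfolding s_def using that by (intro member_le_sum) auto
      then have "s * (A *v z) $ i \<le> \<bar>y $ i / (A *v z) $ i\<bar> * (A *v z) $ i"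
        using z(2) that by (intro mult_right_mono_neg) (auto intro: less_imp_le)
      also have "\<dots> = - \<bar>y $ i\<bar>"
        using z(2) that by (auto simp: abs_divide abs_of_neg field_simps)
      finally show ?thesis by linarith
    qed
    have "s *\<^sub>R z \<in> K"
      using tangent_cone_scaleR[of w R z s] w z(1) by (simp add: s_def sum_nonneg)
    moreover have "y - subvec J A *v (s *\<^sub>R z) \<in> coord_space J \<inter> nonneg_orthant"
      using y s by (auto simp: coord_space_def nonneg_orthant_def less_eq_vec_def subvec_mult_nth
          matrix_vector_mult_scaleR)
    ultimately have "subvec J A *v (s *\<^sub>R z) + (y - subvec J A *v (s *\<^sub>R z))
        \<in> (*v) (subvec J A) ` K + (coord_space J \<inter> nonneg_orthant)"
      by blast
    then show "y \<in> (*v) (subvec J A) ` K + (coord_space J \<inter> nonneg_orthant)"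
      by simp
  qed
  ultimately show ?thesis
    using True by (auto simp: surj_pairs_def)
qed (simp add: surj_pairs_def)

lemma finite_surj_pairs:
  fixes A :: "real^'n^'m"
  assumes "polyhedron R"
  shows "finite (surj_pairs A R)"
proof (rule finite_subset)
  show "surj_pairs A R \<subseteq> (UNIV :: 'm set set) \<times> tangent_cones R"
    by (auto simp: surj_pairs_def)
  show "finite ((UNIV :: 'm set set) \<times> tangent_cones R)"
    using finite_tangent_cones[OF assms] by simp
qed

text \<open>The sign condition is vacuous and 0 lies in the cone. These pairs make the index set of
  the maximum nonempty and contribute the value 0.\<close>

lemma empty_in_surj_pairs:
  assumes "convex R" "w \<in> R"
  shows "({}, tangent_cone R w) \<in> surj_pairs A R"
  using tangent_cone_diff[OF assms(2), of w] assms(2)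
  by (auto simp: surj_pairs_iff[OF assms(1)] tangent_cones_def)

lemma hoffman_ge:
  assumes "polyhedron R" "(J, K) \<in> surj_pairs A R"
  shows "hoffman_pair Nn Nm A J K \<le> hoffman Nn Nm A R"
  unfolding hoffman_def using finite_surj_pairs[OF assms(1), of A] assms(2)
  by (intro Max_ge finite_imageI image_eqI[of _ _ "(J, K)"]) auto

lemma hoffman_attained:
  assumes "polyhedron R" "R \<noteq> {}"
  obtains J K where "(J, K) \<in> surj_pairs A R" "hoffman Nn Nm A R = hoffman_pair Nn Nm A J K"
proof -
  have "surj_pairs A R \<noteq> {}"
    using empty_in_surj_pairs[OF polyhedron_imp_convex[OF assms(1)]] assms(2) by blast
  then have "hoffman Nn Nm A R \<in> (\<lambda>(J, K). hoffman_pair Nn Nm A J K) ` surj_pairs A R"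
    unfolding hoffman_def using finite_surj_pairs[OF assms(1), of A] by (intro Max_in) auto
  then show ?thesis using that by auto
qed

lemma hoffman_nonneg:
  assumes "polyhedron R" "R \<noteq> {}"
  shows "0 \<le> hoffman Nn Nm A R"
proof -
  obtain w where "w \<in> R" using assms(2) by blast
  then have "hoffman_pair Nn Nm A {} (tangent_cone R w) \<le> hoffman Nn Nm A R"
    using assms(1) by (intro hoffman_ge empty_in_surj_pairs polyhedron_imp_convex)
  then show ?thesis by (simp add: hoffman_pair_def)
qed

section \<open>Minimal norm of a solution as a function of the right-hand side\<close>

definition feasible :: "real^'n^'m \<Rightarrow> 'm set \<Rightarrow> (real^'n) set \<Rightarrow> real^'m \<Rightarrow> (real^'n) set" where
  "feasible A J K y = {x \<in> K. \<forall>i\<in>J. (A *v x) $ i \<le> y $ i}"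

definition min_norm ::
    "(real^'n \<Rightarrow> real) \<Rightarrow> real^'n^'m \<Rightarrow> 'm set \<Rightarrow> (real^'n) set \<Rightarrow> real^'m \<Rightarrow> real" where
  "min_norm N A J K y = (INF x\<in>feasible A J K y. N x)"

text \<open>Trades the zero-padded vectors of \<open>hoffman_pair\<close> for inequalities on the
  rows of \<open>J\<close>.\<close>

lemma hoffman_pair_eq:
  "J \<noteq> {} \<Longrightarrow> hoffman_pair Nn Nm A J K = (SUP y\<in>{y. Nm y \<le> 1}. min_norm Nn A J K y)"
  by (simp add: hoffman_pair_def min_norm_def feasible_def subvec_mult_le_iff)

lemma min_norm_le:
  assumes "is_norm N" "x \<in> feasible A J K y"
  shows "min_norm N A J K y \<le> N x"
  unfolding min_norm_def
  by (intro cINF_lower bdd_belowI2[of _ 0] is_norm_nonneg[OF assms(1)] assms(2))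

text \<open>\<open>K\<close> is a cone and the row inequalities are homogeneous; membership in
  \<open>surj_pairs\<close> serves to present \<open>K\<close> as a tangent cone.\<close>

lemma feasible_scaleR:
  assumes "(J, K) \<in> surj_pairs A R" "x \<in> feasible A J K y" "0 \<le> c"
  shows "c *\<^sub>R x \<in> feasible A J K (c *\<^sub>R y)"
proof -
  obtain w where "w \<in> R" "K = tangent_cone R w"
    using assms(1) by (auto simp: surj_pairs_def tangent_cones_def)
  then show ?thesis
    using assms(2,3) tangent_cone_scaleR[of w R x c]
    by (simp add: feasible_def matrix_vector_mult_scaleR mult_left_mono)
qed

lemma feasible_add:
  assumes "convex R" "(J, K) \<in> surj_pairs A R" "x \<in> feasible A J K y" "x' \<in> feasible A J K y'"
  shows "x + x' \<in> feasible A J K (y + y')"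
proof -
  obtain w where "w \<in> R" "K = tangent_cone R w"
    using assms(2) by (auto simp: surj_pairs_def tangent_cones_def)
  then show ?thesis
    using assms(3,4) tangent_cone_add[OF assms(1), of w x x']
    by (simp add: feasible_def matrix_vector_right_distrib add_mono)
qed

text \<open>A fixed multiple of a strictly decreasing direction solves the right-hand side -1. Since
  every component of \<open>y\<close> is at least \<open>- (C * Nm y)\<close>, scaling that solution
  by \<open>C * Nm y\<close> solves \<open>y\<close>, at a cost linear in
  \<open>Nm y\<close>.\<close>

lemma feasible_bounded:
  fixes Nm :: "real^'m \<Rightarrow> real"
  assumes "convex R" "is_norm Nn" "is_norm Nm" "(J, K) \<in> surj_pairs A R"
  obtains M where "M \<ge> 0" "\<forall>y. \<exists>x\<in>feasible A J K y. Nn x \<le> M * Nm y"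
proof -
  obtain z where z: "z \<in> K" "\<forall>i\<in>J. (A *v z) $ i < 0"
    using surj_pairs_iff[OF assms(1), THEN iffD1, OF assms(4)] by blast
  obtain C where C: "C > 0" "\<And>y. norm y \<le> C * Nm y"
    using is_norm_norm_bound[OF assms(3)] by blast
  \<comment> \<open>Chosen so that \<open>s * (A *v z) $ i\<close> \<le> -1 for every
    \<open>i\<close> in \<open>J\<close>.\<close>
  define s where "s = (\<Sum>i\<in>J. \<bar>1 / (A *v z) $ i\<bar>)"
  have s0: "s \<ge> 0" by (simp add: s_def sum_nonneg)
  have "s *\<^sub>R z \<in> feasible A J K (- 1)"
  proof -
    have "s *\<^sub>R z \<in> K"
      using assms(4) z(1) s0
      by (auto simp: surj_pairs_def tangent_cones_def intro: tangent_cone_scaleR)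
    moreover have "s * (A *v z) $ i \<le> - 1" if "i \<in> J" for i
    proof -
      have "\<bar>1 / (A *v z) $ i\<bar> \<le> s"
        unfolding s_def using that by (intro member_le_sum) auto
      then have "s * (A *v z) $ i \<le> \<bar>1 / (A *v z) $ i\<bar> * (A *v z) $ i"
        using z(2) that by (intro mult_right_mono_neg) (auto intro: less_imp_le)
      also have "\<dots> = - 1"
        using z(2) that by (auto simp: abs_divide abs_of_neg field_simps)
      finally show ?thesis .
    qed
    ultimately show ?thesis
      by (auto simp: feasible_def matrix_vector_mult_scaleR)
  qed
  note fz = feasible_scaleR[OF assms(4) this]
  show ?thesis
  proof
    show "0 \<le> C * Nn (s *\<^sub>R z)"
      using C(1) is_norm_nonneg[OF assms(2)] by simp
    show "\<forall>y. \<exists>x\<in>feasible A J K y. Nn x \<le> C * Nn (s *\<^sub>R z) * Nm y"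
    proof
      fix y
      have nn: "0 \<le> C * Nm y"
        using C(1) is_norm_nonneg[OF assms(3)] by simp
      have "- (C * Nm y) \<le> y $ i" for i
        using component_le_norm_cart[of y i] C(2)[of y] by linarith
      then have "(C * Nm y) *\<^sub>R s *\<^sub>R z \<in> feasible A J K y"
        using fz[OF nn] by (auto simp: feasible_def intro: order_trans)
      moreover have "Nn ((C * Nm y) *\<^sub>R s *\<^sub>R z) \<le> C * Nn (s *\<^sub>R z) * Nm y"
        using nn is_norm_scaleR[OF assms(2), of "C * Nm y" "s *\<^sub>R z"] by simp
      ultimately show "\<exists>x\<in>feasible A J K y. Nn x \<le> C * Nn (s *\<^sub>R z) * Nm y" ..
    qed
  qed
qed

lemma min_norm_bounded:
  fixes Nm :: "real^'m \<Rightarrow> real"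
  assumes "convex R" "is_norm Nn" "is_norm Nm" "(J, K) \<in> surj_pairs A R"
  obtains M where "M \<ge> 0" "\<forall>y. min_norm Nn A J K y \<le> M * Nm y"
proof -
  obtain M where M: "M \<ge> 0" "\<forall>y. \<exists>x\<in>feasible A J K y. Nn x \<le> M * Nm y"
    using feasible_bounded[OF assms] .
  show ?thesis
  proof
    show "\<forall>y. min_norm Nn A J K y \<le> M * Nm y"
      using M(2) min_norm_le[OF assms(2)] by (meson order_trans)
  qed (rule M(1))
qed

lemma feasible_nonempty:
  assumes "convex R" "(J, K) \<in> surj_pairs A R"
  shows "feasible A J K y \<noteq> {}"
proof -
  show ?thesis
    using feasible_bounded[OF assms(1) is_norm_norm is_norm_norm assms(2)] by blast
qed

text \<open>Solutions for \<open>y\<close> and \<open>y'\<close> add up to a solution for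
  \<open>y + y'\<close>. The infimum is taken over \<open>x'\<close> with \<open>x\<close> fixed,
  then over \<open>x\<close>.\<close>

lemma min_norm_subadditive:
  assumes "convex R" "is_norm N" "(J, K) \<in> surj_pairs A R"
  shows "min_norm N A J K (y + y') \<le> min_norm N A J K y + min_norm N A J K y'"
proof -
  have "min_norm N A J K (y + y') - N x \<le> min_norm N A J K y'" if x: "x \<in> feasible A J K y" for x
  proof (unfold min_norm_def[of _ _ _ _ y'], rule cINF_greatest)
    show "feasible A J K y' \<noteq> {}"
      using feasible_nonempty assms by blast
    fix x' assume "x' \<in> feasible A J K y'"
    then have "min_norm N A J K (y + y') \<le> N (x + x')"
      using assms x by (intro min_norm_le feasible_add)
    also have "\<dots> \<le> N x + N x'"
      using assms by (simp add: is_norm_triangle)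
    finally show "min_norm N A J K (y + y') - N x \<le> N x'" by simp
  qed
  then have "min_norm N A J K (y + y') - min_norm N A J K y' \<le> N x"
    if "x \<in> feasible A J K y" for x
    using that by (simp add: algebra_simps)
  then have "min_norm N A J K (y + y') - min_norm N A J K y' \<le> min_norm N A J K y"
    unfolding min_norm_def[of _ _ _ _ y]
    using feasible_nonempty[OF assms(1,3)] by (intro cINF_greatest) auto
  then show ?thesis by simp
qed

text \<open>Subadditivity bounds the difference of the values at \<open>y\<close> and
  \<open>y'\<close> by the value at \<open>y - y'\<close>, which is at most
  \<open>M * norm (y - y')\<close>; exchanging \<open>y\<close> and \<open>y'\<close> gives a
  Lipschitz estimate.\<close>

lemma continuous_on_min_norm:
  assumes "convex R" "is_norm N" "(J, K) \<in> surj_pairs A R"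
  shows "continuous_on S (min_norm N A J K)"
proof -
  obtain M where M: "M \<ge> 0" "\<forall>y. min_norm N A J K y \<le> M * norm y"
    using min_norm_bounded[OF assms(1,2) is_norm_norm assms(3)] .
  have "min_norm N A J K y - min_norm N A J K y' \<le> M * norm (y - y')" for y y'
    using min_norm_subadditive[OF assms, of "y - y'" y'] M(2)[rule_format, of "y - y'"] by simp
  then have "\<bar>min_norm N A J K y - min_norm N A J K y'\<bar> \<le> M * norm (y - y')" for y y'
    by (smt (verit) norm_minus_commute)
  then have "M-lipschitz_on S (min_norm N A J K)"
    using M(1) by (intro lipschitz_onI) (auto simp: dist_norm)
  then show ?thesis
    by (rule lipschitz_on_continuous_on)
qed

text \<open>The linear bound on \<open>min_norm\<close> keeps the supremum over the unit ball
  finite.\<close>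

lemma hoffman_pair_ge:
  assumes "convex R" "is_norm Nn" "is_norm Nm" "(J, K) \<in> surj_pairs A R" "J \<noteq> {}" "Nm y \<le> 1"
  shows "min_norm Nn A J K y \<le> hoffman_pair Nn Nm A J K"
proof -
  obtain M where M: "M \<ge> 0" "\<forall>y. min_norm Nn A J K y \<le> M * Nm y"
    using min_norm_bounded[OF assms(1-4)] .
  have "bdd_above (min_norm Nn A J K ` {y. Nm y \<le> 1})"
  proof (rule bdd_aboveI2)
    fix y assume "y \<in> {y. Nm y \<le> 1}"
    then show "min_norm Nn A J K y \<le> M"
      using M(2)[rule_format, of y] M(1) mult_left_le[of "Nm y" M] by simp
  qed
  then show ?thesis
    using assms(5,6) by (auto simp: hoffman_pair_eq intro: cSUP_upper)
qed

text \<open>A continuous function attains its maximum on the compact unit ball of \<open>Nm\<close>;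
  the maximizer is needed for tightness.\<close>

lemma hoffman_pair_attained:
  assumes "convex R" "is_norm Nn" "is_norm Nm" "(J, K) \<in> surj_pairs A R" "J \<noteq> {}"
  obtains y where "Nm y \<le> 1" "min_norm Nn A J K y = hoffman_pair Nn Nm A J K"
proof -
  have "{y. Nm y \<le> 1} = {y. Nm (0 - y) \<le> 1}"
    using is_norm_uminus[OF assms(3)] by simp
  then have "compact {y. Nm y \<le> 1}"
    using is_norm_compact_cball[OF assms(3), of 0] by simp
  moreover have "{y. Nm y \<le> 1} \<noteq> {}"
    using is_norm_eq_0[OF assms(3), of 0] by (auto intro!: exI[of _ 0])
  ultimately have "\<exists>y\<in>{y. Nm y \<le> 1}. \<forall>y'\<in>{y. Nm y \<le> 1}.
      min_norm Nn A J K y' \<le> min_norm Nn A J K y"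
    using continuous_on_min_norm[OF assms(1,2,4)] by (intro continuous_attains_sup)
  then obtain y where y: "Nm y \<le> 1"
    "\<And>y'. Nm y' \<le> 1 \<Longrightarrow> min_norm Nn A J K y' \<le> min_norm Nn A J K y"
    by blast
  have "hoffman_pair Nn Nm A J K \<le> min_norm Nn A J K y"
    using y \<open>{y. Nm y \<le> 1} \<noteq> {}\<close> assms(5)
    by (auto simp: hoffman_pair_eq intro!: cSUP_least)
  then show ?thesis
    using that[OF y(1)] hoffman_pair_ge[OF assms y(1)] by simp
qed


subsection \<open>The error bound\<close>

lemma closed_solution_set: "closed (solution_set A b)"
proof -
  have "solution_set A b = (\<Inter>i. {x. (A *v x) $ i \<le> b $ i})"
    by (auto simp: solution_set_def less_eq_vec_def)
  then show ?thesis
    by (auto intro!: closed_INT closed_Collect_le continuous_on_component continuous_on_const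
        matrix_vector_mult_linear_continuous_on)
qed

lemma nearest_point_norm_le:
  assumes "convex R" "is_norm N" "u \<in> R" "p \<in> solution_set A b \<inter> R"
    and nearest: "\<And>x. x \<in> solution_set A b \<inter> R \<Longrightarrow> N (u - p) \<le> N (u - x)"
    and "z \<in> feasible A {i. (A *v p) $ i = b $ i} (tangent_cone R p) (b - A *v u)"
  shows "N (u - p) \<le> N z"
proof -
  \<comment> \<open>The direction d is feasible at p, and p + t d deviates from u by (1 - t)(u - p) - t z.\<close>
  define d where "d = z + (u - p)"
  have d: "d \<in> tangent_cone R p"
    using assms unfolding d_def
    by (intro tangent_cone_add tangent_cone_diff) (auto simp: feasible_def)
  \<comment> \<open>On an active row, \<open>A *v d\<close> equals \<open>A *v z\<close> plus
    \<open>A *v u\<close> minus \<open>b\<close>, hence is nonpositive; the other rows have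
    slack.\<close>
  have "\<forall>\<^sub>F t in at_right 0. (A *v p) $ i + t * (A *v d) $ i \<le> b $ i" for i
  proof (cases "(A *v p) $ i = b $ i")
    case True
    then have "(A *v d) $ i \<le> 0"
      using assms(6) by (auto simp: feasible_def d_def matrix_vector_right_distrib
          matrix_vector_mult_diff_distrib)
    then show ?thesis
      using True eventually_at_right_less[of "0::real"]
      by (auto elim!: eventually_mono simp: mult_nonneg_nonpos)
  next
    case False
    then show ?thesis
      using assms(4) by (intro eventually_add_mult_le_at_right_0)
        (auto simp: solution_set_def less_eq_vec_def less_le)
  qed
  then have "\<forall>\<^sub>F t in at_right 0. \<forall>i. (A *v p) $ i + t * (A *v d) $ i \<le> b $ i"
    by (rule eventually_all_finite)
  moreover have "\<forall>\<^sub>F t in at_right 0. p + t *\<^sub>R d \<in> R"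
    using assms(1,4) d by (intro tangent_cone_eventually) auto
  moreover have "\<forall>\<^sub>F t in at_right 0. t < (1::real)"
    by (rule order_tendstoD(2)[OF tendsto_ident_at]) simp
  ultimately have "\<forall>\<^sub>F t in at_right 0. t < 1 \<and> p + t *\<^sub>R d \<in> solution_set A b \<inter> R"
    by eventually_elim (auto simp: solution_set_def less_eq_vec_def matrix_vector_right_distrib
        matrix_vector_mult_scaleR)
  then obtain t where t: "0 < t" "t < 1" "p + t *\<^sub>R d \<in> solution_set A b \<inter> R"
    by (rule eventually_at_right_0E) blast
  have "N (u - p) \<le> N (u - (p + t *\<^sub>R d))"
    using nearest t(3) .
  also have "u - (p + t *\<^sub>R d) = (1 - t) *\<^sub>R (u - p) + (- t) *\<^sub>R z"
    by (simp add: d_def algebra_simps)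
  also have "N \<dots> \<le> N ((1 - t) *\<^sub>R (u - p)) + N ((- t) *\<^sub>R z)"
    by (rule is_norm_triangle[OF assms(2)])
  also have "\<dots> = (1 - t) * N (u - p) + t * N z"
    using t by (simp only: is_norm_scaleR[OF assms(2)] abs_minus_cancel abs_of_pos diff_gt_0_iff_gt)
  finally show ?thesis
    using t(1) by (simp add: algebra_simps)
qed

text \<open>The vector \<open>y\<close> may be any lower bound of the residual, so that subtracting
  orthant vectors later produces the distance to the orthant.\<close>

lemma error_bound_strictly_feasible:
  fixes A :: "real^'n^'m"
  assumes "is_norm Nn" "is_norm Nm" "polyhedron R" "u \<in> R" "y \<le> b - A *v u"
    and slater: "x0 \<in> R" "\<And>i. (A *v x0) $ i < b $ i"
  obtains p where "p \<in> solution_set A b \<inter> R" "Nn (u - p) \<le> hoffman Nn Nm A R * Nm y"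
proof -
  have cR: "convex R" using assms(3) by (rule polyhedron_imp_convex)
  have "x0 \<in> solution_set A b \<inter> R"
    using slater by (auto simp: solution_set_def less_eq_vec_def less_imp_le)
  moreover have "closed (solution_set A b \<inter> R)"
    using closed_solution_set polyhedron_imp_closed[OF assms(3)] by blast
  ultimately obtain p where p: "p \<in> solution_set A b \<inter> R"
    "\<And>x. x \<in> solution_set A b \<inter> R \<Longrightarrow> Nn (u - p) \<le> Nn (u - x)"
    using is_norm_nearest_point[OF assms(1)] by blast
  define J where "J = {i. (A *v p) $ i = b $ i}"
  define K where "K = tangent_cone R p"
  have "x0 - p \<in> K"
    using slater(1) by (simp add: K_def tangent_cone_diff)
  moreover have "(A *v (x0 - p)) $ i < 0" if "i \<in> J" for i
    using slater(2)[of i] that by (simp add: J_def matrix_vector_mult_diff_distrib)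
  ultimately have JK: "(J, K) \<in> surj_pairs A R"
    using p(1) by (auto simp: surj_pairs_iff[OF cR] tangent_cones_def K_def)
  have le: "Nn (u - p) \<le> Nn z" if "z \<in> feasible A J K y" for z
    using that assms(5) unfolding J_def K_def
    by (intro nearest_point_norm_le[OF cR assms(1,4) p])
      (auto simp: feasible_def less_eq_vec_def intro: order_trans)
  have "Nn (u - p) \<le> hoffman Nn Nm A R * Nm y"
  \<comment> \<open>In the exceptional cases 0 is feasible, which forces \<open>u = p\<close>.
    Otherwise \<open>y\<close> can be normalized to the unit ball and the constant of a pair with
    nonempty \<open>J\<close> applies.\<close>
  proof (cases "J = {} \<or> y = 0")
    case True
    have "0 \<in> K"
      using p(1) tangent_cone_diff[of p R p] by (simp add: K_def)
    then have "0 \<in> feasible A J K y"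
      using True by (auto simp: feasible_def)
    then have "Nn (u - p) \<le> 0"
      using le is_norm_eq_0[OF assms(1), of 0] by fastforce
    then show ?thesis
      using hoffman_nonneg[OF assms(3)] assms(4) is_norm_nonneg[OF assms(2)]
      by (metis empty_iff mult_nonneg_nonneg order_trans)
  next
    case False
    then have pos: "Nm y > 0"
      using is_norm_nonneg[OF assms(2), of y] is_norm_eq_0[OF assms(2), of y] by simp
    let ?y = "(1 / Nm y) *\<^sub>R y"
    have "Nn (u - p) / Nm y \<le> Nn z" if "z \<in> feasible A J K ?y" for z
    proof -
      have "Nm y *\<^sub>R z \<in> feasible A J K y"
        using feasible_scaleR[OF JK that, of "Nm y"] pos by simp
      then have "Nn (u - p) \<le> Nm y * Nn z"
        using le[of "Nm y *\<^sub>R z"] pos is_norm_scaleR[OF assms(1)] by simp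
      then show ?thesis
        using pos by (simp add: field_simps)
    qed
    then have "Nn (u - p) / Nm y \<le> min_norm Nn A J K ?y"
      unfolding min_norm_def using feasible_nonempty[OF cR JK] by (intro cINF_greatest) auto
    also have "\<dots> \<le> hoffman_pair Nn Nm A J K"
      using False pos is_norm_scaleR[OF assms(2)]
      by (intro hoffman_pair_ge[OF cR assms(1,2) JK]) auto
    also have "\<dots> \<le> hoffman Nn Nm A R"
      by (rule hoffman_ge[OF assms(3) JK])
    finally show ?thesis
      using pos by (simp add: field_simps)
  qed
  then show ?thesis using that p(1) by blast
qed

text \<open>Feasibility of the system need not be strict: relax it by a multiple of the all-ones vector
  and pass to the limit by compactness.\<close>

lemma error_bound:
  fixes A :: "real^'n^'m"
  assumes "is_norm Nn" "is_norm Nm" "polyhedron R" "u \<in> R" "y \<le> b - A *v u"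
    and "solution_set A b \<inter> R \<noteq> {}"
  obtains p where "p \<in> solution_set A b \<inter> R" "Nn (u - p) \<le> hoffman Nn Nm A R * Nm y"
proof -
  let ?\<rho> = "hoffman Nn Nm A R * Nm y"
  define e where "e n = inverse (real (Suc n))" for n
  have e_pos: "e n > 0" for n by (simp add: e_def)
  let ?b = "\<lambda>n. b + e n *\<^sub>R 1"
  \<comment> \<open>Solutions of the relaxed system within the radius \<open>?\<rho>\<close> of
    \<open>u\<close>: a decreasing sequence of compact sets.\<close>
  define S where "S n = {x. Nn (u - x) \<le> ?\<rho>} \<inter> (solution_set A (?b n) \<inter> R)" for n
  obtain x0 where x0: "x0 \<in> solution_set A b" "x0 \<in> R"
    using assms(6) by blast
  have "\<Inter> (range S) \<noteq> {}"
  proof (rule compact_nest)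
    show "compact (S n)" for n
      unfolding S_def
      by (intro compact_Int_closed is_norm_compact_cball[OF assms(1)] closed_Int
          closed_solution_set polyhedron_imp_closed[OF assms(3)])
    show "S n \<noteq> {}" for n
    proof -
      \<comment> \<open>The same \<open>y\<close> stays below every relaxed residual, so the radius
        does not depend on \<open>n\<close>.\<close>
      have "y $ i \<le> (?b n - A *v u) $ i" for i
        using assms(5)[unfolded less_eq_vec_def, rule_format, of i] e_pos[of n] by simp
      then have "y \<le> ?b n - A *v u"
        by (simp only: less_eq_vec_def) blast
      moreover have "(A *v x0) $ i < ?b n $ i" for i
        using x0(1)[unfolded solution_set_def less_eq_vec_def mem_Collect_eq, rule_format, of i] e_pos[of n]
        by simp
      ultimately obtain p where "p \<in> solution_set A (?b n) \<inter> R" "Nn (u - p) \<le> ?\<rho>"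
        by (rule error_bound_strictly_feasible[OF assms(1-4) _ x0(2)])
      then have "p \<in> S n" by (simp add: S_def)
      then show ?thesis by blast
    qed
    show "S n \<subseteq> S m" if "m \<le> n" for m n
    proof -
      have "e n \<le> e m" using that by (simp add: e_def)
      then have "b $ i + e n \<le> b $ i + e m" for i by simp
      then have "solution_set A (?b n) \<subseteq> solution_set A (?b m)"
        unfolding solution_set_def less_eq_vec_def
        by (auto intro: order_trans)
      then show ?thesis
        unfolding S_def by blast
    qed
  qed
  then obtain p where p: "p \<in> S n" for n by blast
  have "(A *v p) $ i \<le> b $ i" for i
  proof (rule LIMSEQ_le_const[OF LIMSEQ_inverse_real_of_nat_add])
    show "\<exists>N. \<forall>n\<ge>N. (A *v p) $ i \<le> b $ i + inverse (real (Suc n))"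
      using p by (simp add: S_def solution_set_def less_eq_vec_def e_def)
  qed
  then have "p \<in> solution_set A b \<inter> R"
    using p[of 0] by (auto simp: S_def solution_set_def less_eq_vec_def)
  then show ?thesis
    using that p[of 0] by (simp add: S_def)
qed

section \<open>Solvability of the system and the bound in terms of distances\<close>

lemma solution_set_Int_nonempty_iff:
  "solution_set A b \<inter> R \<noteq> {} \<longleftrightarrow> b \<in> (*v) A ` R + nonneg_orthant"
proof
  assume "solution_set A b \<inter> R \<noteq> {}"
  then obtain x where x: "x \<in> R" "A *v x \<le> b"
    by (auto simp: solution_set_def)
  then have "A *v x + (b - A *v x) \<in> (*v) A ` R + nonneg_orthant"
    by (intro set_plus_intro) (auto simp: nonneg_orthant_def less_eq_vec_def)
  then show "b \<in> (*v) A ` R + nonneg_orthant" by simp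
next
  assume "b \<in> (*v) A ` R + nonneg_orthant"
  then obtain x v where "x \<in> R" "0 \<le> v" "b = A *v x + v"
    by (auto simp: nonneg_orthant_def elim!: set_plus_elim)
  then have "x \<in> solution_set A b \<inter> R"
    by (auto simp: solution_set_def less_eq_vec_def)
  then show "solution_set A b \<inter> R \<noteq> {}" by blast
qed

text \<open>Each orthant vector \<open>v\<close> gives the admissible choice
  \<open>b - A *v u - v\<close> of \<open>y\<close> in \<open>error_bound\<close>; the infimum over
  \<open>v\<close> is the distance.\<close>

lemma norm_dist_solution_set_le:
  fixes A :: "real^'n^'m"
  assumes "is_norm Nn" "is_norm Nm" "polyhedron R" "u \<in> R"
    and "solution_set A b \<inter> R \<noteq> {}"
  shows "norm_dist Nn u (solution_set A b \<inter> R)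
    \<le> hoffman Nn Nm A R * norm_dist Nm (b - A *v u) nonneg_orthant"
proof -
  let ?D = "norm_dist Nn u (solution_set A b \<inter> R)" and ?H = "hoffman Nn Nm A R"
  have *: "?D \<le> ?H * Nm (b - A *v u - v)" if "v \<in> nonneg_orthant" for v
  proof -
    have "b - A *v u - v \<le> b - A *v u"
      using that by (auto simp: nonneg_orthant_def less_eq_vec_def)
    then obtain p where "p \<in> solution_set A b \<inter> R" "Nn (u - p) \<le> ?H * Nm (b - A *v u - v)"
      using error_bound[OF assms(1-4) _ assms(5)] by blast
    then show ?thesis
      using norm_dist_le[OF assms(1)] order_trans by blast
  qed
  have ne: "0 \<in> nonneg_orthant" by (simp add: nonneg_orthant_def)
  show ?thesis
  \<comment> \<open>Pulling the factor out of the infimum divides by it, so zero is treated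
    apart.\<close>
  proof (cases "?H = 0")
    case True
    then show ?thesis using *[OF ne] by simp
  next
    case False
    then have pos: "?H > 0"
      using hoffman_nonneg[OF assms(3), of Nn Nm A] assms(4) by force
    have "?D / ?H \<le> norm_dist Nm (b - A *v u) nonneg_orthant"
      using * ne pos by (intro le_norm_dist) (auto simp: field_simps)
    then show ?thesis
      using pos by (simp add: field_simps)
  qed
qed

text \<open>The positive part of \<open>- y\<close> is a point of the orthant, and its difference
  from \<open>- y\<close> is minus the positive part of \<open>y\<close>.\<close>

lemma norm_dist_nonneg_orthant_le:
  assumes "is_norm N"
  shows "norm_dist N (- y) nonneg_orthant \<le> N (pos_part y)"
proof -
  have "norm_dist N (- y) nonneg_orthant \<le> N (- y - pos_part (- y))"
    using assms by (intro norm_dist_le) (auto simp: nonneg_orthant_def pos_part_def less_eq_vec_def)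
  also have "- y - pos_part (- y) = - pos_part y"
    by (auto simp: vec_eq_iff pos_part_def)
  finally show ?thesis
    using is_norm_uminus[OF assms] by simp
qed

text \<open>At the apex u of an optimal cone K, a small multiple of an optimal right-hand side y is used
  in the rows of J; the other rows are made redundant, which can only decrease the residual.\<close>

lemma error_bound_tight:
  fixes A :: "real^'n^'m"
  assumes "is_norm Nn" "is_norm Nm" "polyhedron R" "R \<noteq> {}"
    and pos: "hoffman Nn Nm A R > 0"
  obtains b u where "solution_set A b \<inter> R \<noteq> {}" "u \<in> R"
    "norm_dist Nn u (solution_set A b \<inter> R)
      = hoffman Nn Nm A R * norm_dist Nm (b - A *v u) nonneg_orthant"
    "hoffman Nn Nm A R * norm_dist Nm (b - A *v u) nonneg_orthant > 0"
proof -
  let ?H = "hoffman Nn Nm A R"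
  have cR: "convex R" using assms(3) by (rule polyhedron_imp_convex)
  obtain J K where JK: "(J, K) \<in> surj_pairs A R" "?H = hoffman_pair Nn Nm A J K"
    using hoffman_attained[OF assms(3,4)] .
  have "J \<noteq> {}" using pos JK(2) by (auto simp: hoffman_pair_def)
  then obtain y where y: "Nm y \<le> 1" "min_norm Nn A J K y = ?H"
    using hoffman_pair_attained[OF cR assms(1,2) JK(1)] JK(2) by metis
  obtain u where u: "u \<in> R" "K = tangent_cone R u"
    using JK(1) by (auto simp: surj_pairs_def tangent_cones_def)
  obtain z where z: "z \<in> feasible A J K y"
    using feasible_nonempty[OF cR JK(1)] by blast
  then obtain t where t: "t > 0" "u + t *\<^sub>R z \<in> R"
    using u by (auto simp: feasible_def tangent_cone_def)
  \<comment> \<open>Agrees with \<open>y\<close> on \<open>J\<close>; elsewhere it is raised just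
    enough for \<open>z\<close> to satisfy every row.\<close>
  define y' where "y' = (\<chi> i. if i \<in> J then y $ i else max (y $ i) ((A *v z) $ i))"
  define b where "b = A *v u + t *\<^sub>R y'"
  have "A *v z \<le> y'"
    using z by (auto simp: y'_def feasible_def less_eq_vec_def)
  then have sol: "u + t *\<^sub>R z \<in> solution_set A b \<inter> R"
    using t by (auto simp: solution_set_def b_def less_eq_vec_def matrix_vector_right_distrib
        matrix_vector_mult_scaleR)
  \<comment> \<open>For a solution \<open>x\<close>, the vector \<open>x - u\<close> lies in
    \<open>K\<close> and solves the rows of \<open>J\<close> for \<open>t *\<^sub>R y\<close>;
    dividing by \<open>t\<close> and using that \<open>y\<close> is a maximizer bounds its norm
    below.\<close>
  have lower: "t * ?H \<le> norm_dist Nn u (solution_set A b \<inter> R)"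
  proof (rule le_norm_dist)
    fix x assume x: "x \<in> solution_set A b \<inter> R"
    have "x - u \<in> feasible A J K (t *\<^sub>R y)"
    proof -
      have "(A *v x) $ i \<le> (A *v u) $ i + t * y $ i" if "i \<in> J" for i
        using x that by (auto simp: solution_set_def less_eq_vec_def b_def y'_def dest!: spec[of _ i])
      then show ?thesis
        using x u tangent_cone_diff[of x R u]
        by (force simp: feasible_def matrix_vector_mult_diff_distrib algebra_simps)
    qed
    then have "(1 / t) *\<^sub>R (x - u) \<in> feasible A J K y"
      using feasible_scaleR[OF JK(1), of "x - u" "t *\<^sub>R y" "1 / t"] t(1) by simp
    then have "?H \<le> Nn ((1 / t) *\<^sub>R (x - u))"
      using min_norm_le[OF assms(1)] y(2) by metis
    also have "\<dots> = Nn (u - x) / t"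
      using is_norm_scaleR[OF assms(1), of "1/t" "x - u"] is_norm_uminus[OF assms(1), of "u - x"] t(1)
      by simp
    finally show "t * ?H \<le> Nn (u - x)"
      using t(1) by (simp add: field_simps)
  qed (use sol in blast)
  \<comment> \<open>The orthant vector \<open>t *\<^sub>R (y' - y)\<close> absorbs the raised rows
    and leaves \<open>t *\<^sub>R y\<close>, of norm at most \<open>t\<close>.\<close>
  have "norm_dist Nm (b - A *v u) nonneg_orthant \<le> Nm (t *\<^sub>R y' - t *\<^sub>R (y' - y))"
    using norm_dist_le[OF assms(2), of "t *\<^sub>R (y' - y)"] t(1)
    by (auto simp: b_def nonneg_orthant_def less_eq_vec_def y'_def)
  also have "t *\<^sub>R y' - t *\<^sub>R (y' - y) = t *\<^sub>R y"
    by (simp add: algebra_simps)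
  also have "Nm (t *\<^sub>R y) \<le> t"
    using t(1) y(1) is_norm_scaleR[OF assms(2), of t y] by simp
  finally have "?H * norm_dist Nm (b - A *v u) nonneg_orthant \<le> t * ?H"
    using pos by simp
  moreover have "norm_dist Nn u (solution_set A b \<inter> R)
      \<le> ?H * norm_dist Nm (b - A *v u) nonneg_orthant"
    using sol u(1) by (intro norm_dist_solution_set_le[OF assms(1-3)]) auto
  moreover have "t * ?H > 0" using t(1) pos by simp
  \<comment> \<open>The chain from \<open>t * ?H\<close> through both distance terms back to
    \<open>t * ?H\<close> forces equality, and \<open>t * ?H\<close> is positive.\<close>
  ultimately show ?thesis
    using that[of b u] sol u(1) lower by fastforce
qed

theorem proposition3:
  fixes A :: "real^'n^'m"
    and R :: "(real^'n) set"
    and Nn :: "real^'n \<Rightarrow> real"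
    and Nm :: "real^'m \<Rightarrow> real"
  assumes "is_norm Nn" and "is_norm Nm"
    and "polyhedron R" and "R \<noteq> {}"
  shows "(\<forall>b \<in> (*v) A ` R + nonneg_orthant. \<forall>u \<in> R.
            norm_dist Nn u (solution_set A b \<inter> R)
              \<le> hoffman Nn Nm A R * norm_dist Nm (b - A *v u) nonneg_orthant \<and>
            hoffman Nn Nm A R * norm_dist Nm (b - A *v u) nonneg_orthant
              \<le> hoffman Nn Nm A R * Nm (pos_part (A *v u - b))) \<and>
         (hoffman Nn Nm A R > 0 \<longrightarrow>
          (\<exists>b \<in> (*v) A ` R + nonneg_orthant. \<exists>u \<in> R.
            norm_dist Nn u (solution_set A b \<inter> R)
              = hoffman Nn Nm A R * norm_dist Nm (b - A *v u) nonneg_orthant \<and>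
            hoffman Nn Nm A R * norm_dist Nm (b - A *v u) nonneg_orthant > 0))"
proof (intro conjI ballI impI)
  fix b u assume b: "b \<in> (*v) A ` R + nonneg_orthant" and u: "u \<in> R"
  show "norm_dist Nn u (solution_set A b \<inter> R)
      \<le> hoffman Nn Nm A R * norm_dist Nm (b - A *v u) nonneg_orthant"
    using b u assms by (intro norm_dist_solution_set_le) (auto simp: solution_set_Int_nonempty_iff)
  show "hoffman Nn Nm A R * norm_dist Nm (b - A *v u) nonneg_orthant
      \<le> hoffman Nn Nm A R * Nm (pos_part (A *v u - b))"
    using norm_dist_nonneg_orthant_le[OF assms(2), of "A *v u - b"] hoffman_nonneg[OF assms(3,4)]
    by (intro mult_left_mono) auto
next
  assume "hoffman Nn Nm A R > 0"
  from error_bound_tight[OF assms this]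
  show "\<exists>b \<in> (*v) A ` R + nonneg_orthant. \<exists>u \<in> R.
      norm_dist Nn u (solution_set A b \<inter> R)
        = hoffman Nn Nm A R * norm_dist Nm (b - A *v u) nonneg_orthant \<and>
      hoffman Nn Nm A R * norm_dist Nm (b - A *v u) nonneg_orthant > 0"
    by (metis solution_set_Int_nonempty_iff)
qed

end
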